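(* (a) For $|z|<1$ and positive integers $M,r_1,\dots,r_M$, $$\sum_{n=1}^\infty\Big[\prod_{j=1}^M\mathsf H_n^{(r_j)}\Big]z^n\in\frac{1}{1-z}\mathrm{Span}_{\mathbb Q}\Big\{L_{\mathbf A}(z)\;\Big|\;w(\mathbf A)=\sum_{j=1}^M r_j\Big\}=\frac{\mathfrak G^{(z)}_{\sum_{j} r_j}(1)}{1-z}.$$ Moreover, for $s\in\mathbb Z_{>0}$ and $k=s+\sum_{j=1}^M r_j$, $$\sum_{n=1}^\infty\Big[\prod_{j=1}^M\mathsf H_n^{(r_j)}\Big]\frac{1}{n^{s+1}}\in\mathfrak Z_{k+1}(1),\qquad \sum_{n=1}^\infty\Big[\prod_{j=1}^M\mathsf H_n^{(r_j)}\Big]\frac{(-1)^n}{n^{s}}\in\mathfrak Z_{k}(2).$$ (b) For $|z|<1$ and positive integers $M,\overline M,r_1,\dots,r_M,\overline r_1,\dots,\overline r_{\overline M}$, $$\sum_{n=1}^\infty\Big[\prod_{j=1}^M\mathsf H_n^{(r_j)}\Big]\Big[\prod_{\bar j=1}^{\overline M}\overline{\mathsf H}_n^{(\overline r_{\bar j})}\Big]z^n\in\frac{\mathfrak G^{(z)}_{\sum_j r_j+\sum_{\bar j}\overline r_{\bar j}}(2)}{1-z},$$ and for $s\in\mathbb Z_{>0}$ and $k=s+\sum_j r_j+\sum_{\bar j}\overline r_{\bar j}$, $$\sum_{n=1}^\infty\Big[\prod_{j}\mathsf H_n^{(r_j)}\Big]\Big[\prod_{\bar j}\overline{\mathsf H}_n^{(\overline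 r_{\bar j})}\Big]\frac{1}{n^{s+1}}\in\mathfrak Z_{k+1}(2),\qquad \sum_{n=1}^\infty\Big[\prod_{j}\mathsf H_n^{(r_j)}\Big]\Big[\prod_{\bar j}\overline{\mathsf H}_n^{(\overline r_{\bar j})}\Big]\frac{(-1)^n}{n^{s}}\in\mathfrak Z_{k}(2).$$
   Context: $\mathsf H_n^{(r)}=\sum_{k=1}^n k^{-r}$ and $\overline{\mathsf H}_n^{(r)}=\sum_{k=1}^n(-1)^{k-1}k^{-r}$ for $n\in\mathbb Z_{>0}$. For a vector $\mathbf A=(a_1,\dots,a_d)$ of positive integers, $w(\mathbf A)=\sum a_j$ and $L_{\mathbf A}(x)=\sum_{\ell_1>\dots>\ell_d>0}x^{\ell_1}/\prod_j\ell_j^{a_j}$. Generalized polylogarithms: for $(\alpha_1,\dots,\alpha_n)\ne\mathbf 0$, $G(\alpha_1,\dots,\alpha_n;z)=\int_0^z\frac{dx}{x-\alpha_1}G(\alpha_2,\dots,\alpha_n;x)$ (straight path from $0$ to $z$), with $G(\,;z)=1$ and $G(0,\dots,0;z)=\frac{\log^n z}{n!}$ ($n$ zeros). For integers $k,N\ge1$, $\mathfrak G^{(z)}_k(N)$ is the $\mathbb Q$-span of all convergent values $G(\alpha_1,\dots,\alpha_k;z)$ with each of $\alpha_1,\dots,\alpha_{k-1}$ equal to $0$ or an $N$-th root of unity and $\alpha_k^N=1$; $\mathfrak G^{(z)}_0(N)=\mathbb Q$. $\mathrm{Li}_{a_1,\dots,a_n}(z_1,\dots,z_n)=\sum_{\ell_1>\dots>\ell_n>0}\prod_j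 z_j^{\ell_j}/\ell_j^{a_j}$; $\mathfrak Z_k(N)$ is the $\mathbb Q$-span of all convergent $\mathrm{Li}_{a_1,\dots,a_n}(z_1,\dots,z_n)$ with $a_j\in\mathbb Z_{>0}$, $z_j^N=1$, $\sum a_j=k$; $\mathfrak Z_0(N)=\mathbb Q$. *)

theory Defs
  imports "HOL-Complex_Analysis.Complex_Analysis"
begin

definition harm_num :: "nat \<Rightarrow> nat \<Rightarrow> complex" where
  "harm_num r n = (\<Sum>k=1..n. 1 / of_nat k ^ r)"

definition alt_harm_num :: "nat \<Rightarrow> nat \<Rightarrow> complex" where
  "alt_harm_num r n = (\<Sum>k=1..n. (-1) ^ (k - 1) / of_nat k ^ r)"

definition rat_scale :: "rat \<Rightarrow> complex \<Rightarrow> complex" where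
  "rat_scale q x = of_rat q * x"

global_interpretation Q: vector_space rat_scale
  defines rat_span = Q.span
  by unfold_locales (simp_all add: rat_scale_def of_rat_add of_rat_mult algebra_simps)

text \<open>
  Sums over \<open>\<ell>\<^sub>1 > \<dots> > \<ell>\<^sub>d > 0\<close> are limits, as \<open>m\<close> tends to infinity, of the finite sums restricted by
  \<open>m \<ge> \<ell>\<^sub>1\<close>: the outermost summation is the only infinite one, and at roots of unity it may
  converge only conditionally, so that unordered summation would be too restrictive.
\<close>

definition decr_indices :: "nat \<Rightarrow> nat \<Rightarrow> nat list set" where
  "decr_indices d m = {ls. length ls = d \<and> sorted_wrt (>) ls \<and> set ls \<subseteq> {1..m}}"

definition L_partial :: "nat list \<Rightarrow> complex \<Rightarrow> nat \<Rightarrow> complex" where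
  "L_partial as x m =
     (\<Sum>ls\<in>decr_indices (length as) m. x ^ (ls ! 0) / (\<Prod>j<length as. of_nat (ls ! j) ^ (as ! j)))"

definition L_polylog :: "nat list \<Rightarrow> complex \<Rightarrow> complex" where
  "L_polylog as x = lim (L_partial as x)"

definition Li_partial :: "nat list \<Rightarrow> complex list \<Rightarrow> nat \<Rightarrow> complex" where
  "Li_partial as zs m =
     (\<Sum>ls\<in>decr_indices (length as) m. \<Prod>j<length as. (zs ! j) ^ (ls ! j) / of_nat (ls ! j) ^ (as ! j))"

definition Li :: "nat list \<Rightarrow> complex list \<Rightarrow> complex" where
  "Li as zs = lim (Li_partial as zs)"

definition \<ZZ> :: "nat \<Rightarrow> nat \<Rightarrow> complex set" where
  "\<ZZ> k N = (if k = 0 then \<rat> else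
     rat_span {Li as zs | as zs. length zs = length as \<and> (\<forall>a\<in>set as. a \<ge> 1) \<and>
                 (\<forall>\<zeta>\<in>set zs. \<zeta> ^ N = 1) \<and> sum_list as = k \<and> convergent (Li_partial as zs)})"

fun GPL :: "complex list \<Rightarrow> complex \<Rightarrow> complex" where
  "GPL [] z = 1"
| "GPL (\<alpha> # \<alpha>s) z =
     (if \<forall>\<beta>\<in>set (\<alpha> # \<alpha>s). \<beta> = 0
      then Ln z ^ length (\<alpha> # \<alpha>s) / fact (length (\<alpha> # \<alpha>s))
      else contour_integral (linepath 0 z) (\<lambda>x. 1 / (x - \<alpha>) * GPL \<alpha>s x))"

text \<open>Existence of all the integrals (and logarithms) in the recursive definition of \<open>GPL\<close>.\<close>

fun GPL_convergent :: "complex list \<Rightarrow> complex \<Rightarrow> bool" where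
  "GPL_convergent [] z = True"
| "GPL_convergent (\<alpha> # \<alpha>s) z =
     (if \<forall>\<beta>\<in>set (\<alpha> # \<alpha>s). \<beta> = 0
      then z \<noteq> 0
      else (\<forall>x\<in>open_segment 0 z. GPL_convergent \<alpha>s x) \<and>
           (\<lambda>x. 1 / (x - \<alpha>) * GPL \<alpha>s x) contour_integrable_on linepath 0 z)"

definition \<GG> :: "complex \<Rightarrow> nat \<Rightarrow> nat \<Rightarrow> complex set" where
  "\<GG> z k N = (if k = 0 then \<rat> else
     rat_span {GPL \<alpha>s z | \<alpha>s. length \<alpha>s = k \<and> (\<forall>\<alpha>\<in>set (butlast \<alpha>s). \<alpha> = 0 \<or> \<alpha> ^ N = 1) \<and>
                 last \<alpha>s ^ N = 1 \<and> GPL_convergent \<alpha>s z})"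

end

theory Submission imports Defs begin

text \<open>
  A word of letters \<open>(a\<^sub>j, \<sigma>\<^sub>j)\<close> encodes the sum over \<open>n \<ge> \<ell>\<^sub>1 > \<dots> > \<ell>\<^sub>d > 0\<close> of
  \<open>\<Prod>\<^sub>j \<sigma>\<^sub>j^\<ell>\<^sub>j / \<ell>\<^sub>j^a\<^sub>j\<close>. By the stuffle relation, products of (alternating) harmonic numbers at
  \<open>n\<close> are rational combinations of such truncated sums of the same weight. Multiplying their
  generating functions by \<open>1 - z\<close> leaves the series of the terms with \<open>\<ell>\<^sub>1 = n\<close>, which are the power
  series of the functions \<open>G\<close> up to sign; weighting the truncated sums by \<open>\<tau>^n / n^b\<close> instead adds
  a letter in front of the word or merges it into the first letter.
\<close>

section \<open>Truncated multiple sums and the stuffle relation\<close>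

text \<open>
  \<open>word_coeff w n\<close> collects the terms whose largest index is exactly \<open>n\<close>. Division by \<open>0\<close> at
  \<open>n = 0\<close> is harmless, since the inner sum is then empty.
\<close>

fun word_coeff :: "(nat \<times> complex) list \<Rightarrow> nat \<Rightarrow> complex" where
  "word_coeff [] n = (if n = 0 then 1 else 0)"
| "word_coeff ((a, \<sigma>) # w) n = \<sigma> ^ n / of_nat n ^ a * (\<Sum>m<n. word_coeff w m)"

definition word_sum :: "(nat \<times> complex) list \<Rightarrow> nat \<Rightarrow> complex" where
  "word_sum w n = (\<Sum>m\<le>n. word_coeff w m)"

lemma word_sum_Nil [simp]: "word_sum [] n = 1"
  by (simp add: word_sum_def)

lemma word_coeff_Cons_0 [simp]: "word_coeff (x # w) 0 = 0"
  by (cases x) simp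

lemma word_sum_Cons_0 [simp]: "word_sum (x # w) 0 = 0"
  by (simp add: word_sum_def)

lemma word_sum_Suc: "word_sum w (Suc n) = word_sum w n + word_coeff w (Suc n)"
  by (simp add: word_sum_def)

lemma word_coeff_Cons_Suc:
  "word_coeff ((a, \<sigma>) # w) (Suc n) = \<sigma> ^ Suc n / of_nat (Suc n) ^ a * word_sum w n"
  by (simp add: word_sum_def lessThan_Suc_atMost del: of_nat_Suc power_Suc)

lemma word_sum_Cons:
  "word_sum ((a, \<sigma>) # w) n = (\<Sum>l=1..n. \<sigma> ^ l / of_nat l ^ a * word_sum w (l - 1))"
  by (induction n) (simp_all add: word_sum_Suc word_coeff_Cons_Suc del: of_nat_Suc power_Suc word_coeff.simps)

section \<open>Nested sums over decreasing index lists as word sums\<close>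

lemma finite_decr_indices: "finite (decr_indices d m)"
proof (rule finite_subset)
  show "decr_indices d m \<subseteq> {ls. set ls \<subseteq> {1..m} \<and> length ls = d}"
    by (auto simp: decr_indices_def)
qed (rule finite_lists_length_eq, simp)

lemma decr_indices_0: "decr_indices 0 m = {[]}"
  by (auto simp: decr_indices_def)

lemma decr_indices_Suc:
  "decr_indices (Suc d) m = (\<Union>l\<in>{1..m}. (#) l ` decr_indices d (l - 1))" (is "?A = ?B")
proof
  show "?A \<subseteq> ?B"
  proof
    fix ls assume ls: "ls \<in> ?A"
    then obtain l ks where "ls = l # ks" by (cases ls) (auto simp: decr_indices_def)
    with ls have "l \<in> {1..m}" "ks \<in> decr_indices d (l - 1)"
      by (fastforce simp: decr_indices_def)+
    with \<open>ls = l # ks\<close> show "ls \<in> ?B" by auto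
  qed
  show "?B \<subseteq> ?A" by (fastforce simp: decr_indices_def)
qed

lemma sum_decr_indices_Suc:
  "(\<Sum>ls\<in>decr_indices (Suc d) m. f ls) = (\<Sum>l=1..m. \<Sum>ls\<in>decr_indices d (l - 1). f (l # ls))"
  for f :: "nat list \<Rightarrow> 'a::comm_monoid_add"
  unfolding decr_indices_Suc
  by (subst sum.UNION_disjoint) (auto simp: finite_decr_indices sum.reindex)

lemma Li_partial_eq_word_sum:
  "length zs = length as \<Longrightarrow> Li_partial as zs m = word_sum (zip as zs) m"
proof (induction zs as arbitrary: m rule: list_induct2)
  case Nil
  then show ?case by (simp add: Li_partial_def decr_indices_0)
next
  case (Cons z zs a as)
  have "Li_partial (a # as) (z # zs) m = (\<Sum>l=1..m. z ^ l / of_nat l ^ a * Li_partial as zs (l - 1))"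
    by (simp add: Li_partial_def sum_decr_indices_Suc prod.lessThan_Suc_shift sum_distrib_left
        del: prod.lessThan_Suc)
  then show ?case by (simp add: Cons.IH word_sum_Cons)
qed

text \<open>Only the largest index carries \<open>x\<close>. Peeling it off leaves a truncated
  \<open>Li\<close> with all arguments 1, to which \<open>Li_partial_eq_word_sum\<close>
  applies.\<close>

lemma L_partial_eq_word_sum:
  "L_partial (a # as) x m = word_sum ((a, x) # map (\<lambda>b. (b, 1)) as) m"
proof -
  have "Li_partial as (replicate (length as) 1) n = word_sum (map (\<lambda>b. (b, 1)) as) n" for n
    using Li_partial_eq_word_sum[of "replicate (length as) 1" as n]
    by (simp add: zip_replicate2)
  moreover have "L_partial (a # as) x m =
      (\<Sum>l=1..m. x ^ l / of_nat l ^ a * Li_partial as (replicate (length as) 1) (l - 1))"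
    by (simp add: L_partial_def Li_partial_def sum_decr_indices_Suc prod.lessThan_Suc_shift
        sum_distrib_left prod_dividef del: prod.lessThan_Suc)
  ultimately show ?thesis by (simp add: word_sum_Cons)
qed

section \<open>Words of given weight and rational spans of sequences\<close>

text \<open>These words are the index data of \<open>\<ZZ> K N\<close>, with exponents and arguments
  zipped and convergence not yet imposed. As every exponent is positive, \<open>[]\<close> is the
  only word of weight 0.\<close>

definition root_words :: "nat \<Rightarrow> nat \<Rightarrow> (nat \<times> complex) list set" where
  "root_words N K = {w. (\<forall>(a, \<sigma>)\<in>set w. a \<ge> 1 \<and> \<sigma> ^ N = 1) \<and> sum_list (map fst w) = K}"

lemma root_words_Nil: "[] \<in> root_words N 0"
  by (simp add: root_words_def)

lemma root_words_Cons:
  "(a, \<sigma>) # w \<in> root_words N K \<longleftrightarrow> a \<ge> 1 \<and> \<sigma> ^ N = 1 \<and> (\<exists>K'. K = a + K' \<and> w \<in> root_words N K')"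
  by (auto simp: root_words_def)

lemma root_words_Cons_cases:
  assumes "w \<in> root_words N K" "K > 0"
  obtains a \<sigma> v K' where "w = (a, \<sigma>) # v" "a \<ge> 1" "\<sigma> ^ N = 1" "v \<in> root_words N K'" "K = a + K'"
proof (cases w)
  case Nil
  with assms show ?thesis by (simp add: root_words_def)
next
  case (Cons x v)
  with assms that show ?thesis by (cases x) (auto simp: root_words_Cons)
qed

text \<open>The rational span of a set of sequences, whereas \<open>rat_span\<close> is a span of
  numbers. Building elements one scaled generator at a time makes linear extension a plain
  induction.\<close>

inductive_set seq_span :: "(nat \<Rightarrow> complex) set \<Rightarrow> (nat \<Rightarrow> complex) set" for S where
  zero: "(\<lambda>n. 0) \<in> seq_span S"
| step: "g \<in> S \<Longrightarrow> f \<in> seq_span S \<Longrightarrow> (\<lambda>n. of_rat q * g n + f n) \<in> seq_span S"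

lemma seq_span_add:
  "f \<in> seq_span S \<Longrightarrow> g \<in> seq_span S \<Longrightarrow> (\<lambda>n. f n + g n) \<in> seq_span S"
proof (induction rule: seq_span.induct)
  case (step h f q)
  then show ?case using seq_span.step[of h S "\<lambda>n. f n + g n" q] by (simp add: add.assoc)
qed simp

lemma seq_span_scale: "f \<in> seq_span S \<Longrightarrow> (\<lambda>n. of_rat q * f n) \<in> seq_span S"
proof (induction rule: seq_span.induct)
  case zero
  then show ?case by (simp add: seq_span.zero)
next
  case (step h f p)
  then show ?case using seq_span.step[of h S "\<lambda>n. of_rat q * f n" "q * p"]
    by (simp add: of_rat_mult algebra_simps)
qed

lemma seq_span_base: "f \<in> S \<Longrightarrow> f \<in> seq_span S"
  using seq_span.step[OF _ seq_span.zero, of f S 1] by simp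

lemma seq_span_linear_image:
  assumes "f \<in> seq_span S"
    and "\<And>g. g \<in> S \<Longrightarrow> T g \<in> seq_span S'"
    and "T (\<lambda>n. 0) = (\<lambda>n. 0)"
    and "\<And>q g h. T (\<lambda>n. of_rat q * g n + h n) = (\<lambda>n. of_rat q * T g n + T h n)"
  shows "T f \<in> seq_span S'"
  using assms(1)
proof (induction rule: seq_span.induct)
  case zero
  show ?case using assms(3) seq_span.zero by metis
next
  case (step g f q)
  have "T g \<in> seq_span S'" using step.hyps(1) by (rule assms(2))
  then show ?case unfolding assms(4)
    by (intro seq_span_add seq_span_scale step.IH)
qed

text \<open>Summation against a fixed weight \<open>t\<close> is linear only on summable sequences,
  so summability and membership go through the induction together.\<close>

lemma seq_span_suminf:
  assumes "f \<in> seq_span S" "Q.subspace V"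
    and "\<And>g. g \<in> S \<Longrightarrow> summable (\<lambda>n. g (Suc n) * t n) \<and> (\<Sum>n. g (Suc n) * t n) \<in> V"
  shows "summable (\<lambda>n. f (Suc n) * t n) \<and> (\<Sum>n. f (Suc n) * t n) \<in> V"
  using assms(1)
proof (induction rule: seq_span.induct)
  case zero
  then show ?case using Q.subspace_0[OF assms(2)] by simp
next
  case (step g f q)
  have g: "summable (\<lambda>n. g (Suc n) * t n)" "(\<Sum>n. g (Suc n) * t n) \<in> V"
    using assms(3)[OF step.hyps(1)] by auto
  have "(\<lambda>n. of_rat q * (g (Suc n) * t n) + f (Suc n) * t n) sums
      (of_rat q * (\<Sum>n. g (Suc n) * t n) + (\<Sum>n. f (Suc n) * t n))"
    using g(1) step.IH by (intro sums_add sums_mult summable_sums) auto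
  moreover have "of_rat q * (\<Sum>n. g (Suc n) * t n) + (\<Sum>n. f (Suc n) * t n) \<in> V"
    using g(2) step.IH Q.subspace_add[OF assms(2)] Q.subspace_scale[OF assms(2)]
    unfolding rat_scale_def by blast
  ultimately show ?case by (simp add: sums_iff algebra_simps)
qed

abbreviation "word_span N K \<equiv> seq_span (word_sum ` root_words N K)"

section \<open>The stuffle product\<close>

text \<open>Compare the index k of the single letter with the largest index l of the word: k > l
  prepends the letter, k = l merges it with the first one, and k < l leaves a product of sums
  truncated at l - 1. The induction checks that both sides have equal increments in
  \<open>n\<close>.\<close>

lemma stuffle_word_sum:
  "word_sum [(b, \<tau>)] n * word_sum ((a, \<sigma>) # w) n =
     word_sum ((b, \<tau>) # (a, \<sigma>) # w) n + word_sum ((a + b, \<sigma> * \<tau>) # w) n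
     + (\<Sum>l=1..n. \<sigma> ^ l / of_nat l ^ a * (word_sum [(b, \<tau>)] (l - 1) * word_sum w (l - 1)))"
proof (induction n)
  case (Suc n)
  then show ?case unfolding word_sum_Suc word_coeff_Cons_Suc
    by (simp add: algebra_simps power_add del: of_nat_Suc power_Suc)
qed simp

text \<open>Prepending a letter is linear in the inner sum. This handles the last stuffle term,
  whose inner product is known only as an element of a span.\<close>

lemma word_span_prefix:
  assumes "f \<in> word_span N K" "a \<ge> 1" "\<sigma> ^ N = 1"
  shows "(\<lambda>n. \<Sum>l=1..n. \<sigma> ^ l / of_nat l ^ a * f (l - 1)) \<in> word_span N (a + K)"
  using assms(1)
proof (rule seq_span_linear_image)
  fix g assume "g \<in> word_sum ` root_words N K"
  then obtain w where w: "w \<in> root_words N K" "g = word_sum w" by auto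
  have "(\<lambda>n. \<Sum>l=1..n. \<sigma> ^ l / of_nat l ^ a * g (l - 1)) = word_sum ((a, \<sigma>) # w)"
    using w by (simp add: word_sum_Cons fun_eq_iff)
  then show "(\<lambda>n. \<Sum>l=1..n. \<sigma> ^ l / of_nat l ^ a * g (l - 1)) \<in> word_span N (a + K)"
    using w assms(2,3) by (auto intro!: seq_span_base simp: root_words_Cons)
qed (simp_all add: sum_distrib_left sum.distrib algebra_simps)

lemma letter_times_word:
  assumes "w \<in> root_words N K" "b \<ge> 1" "\<tau> ^ N = 1"
  shows "(\<lambda>n. word_sum [(b, \<tau>)] n * word_sum w n) \<in> word_span N (b + K)"
  using assms(1)
proof (induction w arbitrary: K)
  case Nil
  then have "[(b, \<tau>)] \<in> root_words N (b + K)" using assms by (simp add: root_words_def)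
  then show ?case by (auto intro: seq_span_base)
next
  case (Cons x w)
  obtain a \<sigma> where x: "x = (a, \<sigma>)" by (cases x)
  with Cons.prems obtain K' where K': "a \<ge> 1" "\<sigma> ^ N = 1" "K = a + K'" "w \<in> root_words N K'"
    by (auto simp: root_words_Cons)
  have "word_sum ((b, \<tau>) # (a, \<sigma>) # w) \<in> word_span N (b + K)"
    using assms K' by (auto intro!: seq_span_base simp: root_words_Cons)
  moreover have "word_sum ((a + b, \<sigma> * \<tau>) # w) \<in> word_span N (b + K)"
    using assms K' by (auto intro!: seq_span_base simp: root_words_Cons power_mult_distrib)
  moreover have "(\<lambda>n. \<Sum>l=1..n. \<sigma> ^ l / of_nat l ^ a * (word_sum [(b, \<tau>)] (l - 1) * word_sum w (l - 1)))
      \<in> word_span N (b + K)"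
    using word_span_prefix[OF Cons.IH[OF K'(4)] K'(1,2)] K'(3) by (simp add: add.left_commute)
  ultimately show ?case unfolding x stuffle_word_sum
    by (intro seq_span_add) auto
qed

lemma letter_times_word_span:
  assumes "f \<in> word_span N K" "b \<ge> 1" "\<tau> ^ N = 1"
  shows "(\<lambda>n. word_sum [(b, \<tau>)] n * f n) \<in> word_span N (b + K)"
  using assms(1)
proof (rule seq_span_linear_image)
  fix g assume "g \<in> word_sum ` root_words N K"
  then show "(\<lambda>n. word_sum [(b, \<tau>)] n * g n) \<in> word_span N (b + K)"
    using letter_times_word[OF _ assms(2,3)] by auto
qed (simp_all add: algebra_simps)

text \<open>The rational factor \<open>q\<close> absorbs the sign relating
  \<open>alt_harm_num\<close> to a word sum, and the cofactor \<open>f\<close> allows the two kinds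
  of products to be multiplied one after the other.\<close>

lemma prod_letters_times_word_span:
  assumes "finite J" "f \<in> word_span N K" "\<And>j. j \<in> J \<Longrightarrow> r j \<ge> 1" "\<tau> ^ N = 1"
    and "\<And>j n. h j n = of_rat q * word_sum [(r j, \<tau>)] n"
  shows "(\<lambda>n. (\<Prod>j\<in>J. h j n) * f n) \<in> word_span N (sum r J + K)"
  using assms(1,3)
proof (induction J rule: finite_induct)
  case empty
  then show ?case using assms(2) by simp
next
  case (insert i J)
  have "(\<lambda>n. of_rat q * (word_sum [(r i, \<tau>)] n * ((\<Prod>j\<in>J. h j n) * f n))) \<in> word_span N (r i + (sum r J + K))"
    using insert assms(4) by (intro seq_span_scale letter_times_word_span) auto
  then show ?case using insert by (simp add: assms(5) algebra_simps)
qed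

lemma harm_num_eq_word_sum: "harm_num r n = word_sum [(r, 1)] n"
  by (simp add: harm_num_def word_sum_Cons)

lemma alt_harm_num_eq_word_sum: "alt_harm_num r n = - word_sum [(r, -1)] n"
proof -
  have "(-1) ^ (k - 1) = - ((-1) ^ k :: complex)" if "k \<in> {1..n}" for k
    using that by (cases k) auto
  then show ?thesis
    by (simp add: alt_harm_num_def word_sum_Cons sum_negf flip: sum_negf)
qed

lemma prod_harm_num_times_word_span:
  fixes M :: nat
  assumes "\<forall>j\<in>{1..M}. r j \<ge> 1" "f \<in> word_span N K"
  shows "(\<lambda>n. (\<Prod>j=1..M. harm_num (r j) n) * f n) \<in> word_span N ((\<Sum>j=1..M. r j) + K)"
  using assms by (intro prod_letters_times_word_span[where q = 1 and \<tau> = 1])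
    (simp_all add: harm_num_eq_word_sum)

lemma prod_alt_harm_num_times_word_span:
  fixes M :: nat
  assumes "\<forall>j\<in>{1..M}. r j \<ge> 1" "f \<in> word_span 2 K"
  shows "(\<lambda>n. (\<Prod>j=1..M. alt_harm_num (r j) n) * f n) \<in> word_span 2 ((\<Sum>j=1..M. r j) + K)"
  using assms by (intro prod_letters_times_word_span[where q = "-1" and \<tau> = "-1"])
    (simp_all add: alt_harm_num_eq_word_sum)

lemma one_in_word_span: "(\<lambda>n. 1) \<in> word_span N 0"
  by (intro seq_span_base image_eqI[where x = "[]"]) (auto simp: root_words_Nil fun_eq_iff)

lemma prod_harm_num_in_word_span:
  "\<forall>j\<in>{1..M}. r j \<ge> 1 \<Longrightarrow> (\<lambda>n. \<Prod>j=1..M. harm_num (r j) n) \<in> word_span N (\<Sum>j=1..M. r j)"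
  for M :: nat
  using prod_harm_num_times_word_span[OF _ one_in_word_span] by simp

lemma prod_harm_num_alt_harm_num_in_word_span:
  fixes M M' :: nat
  assumes "\<forall>j\<in>{1..M}. r j \<ge> 1" "\<forall>j\<in>{1..M'}. r' j \<ge> 1"
  shows "(\<lambda>n. (\<Prod>j=1..M. harm_num (r j) n) * (\<Prod>j=1..M'. alt_harm_num (r' j) n))
    \<in> word_span 2 ((\<Sum>j=1..M. r j) + (\<Sum>j=1..M'. r' j))"
  using prod_harm_num_times_word_span[OF assms(1)
      prod_alt_harm_num_times_word_span[OF assms(2) one_in_word_span]] by simp

section \<open>Power series of generalized polylogarithms\<close>

text \<open>
  The Taylor coefficients of \<open>GPL\<close> at \<open>0\<close>, read off from \<open>1 / (x - \<alpha>) = - (\<Sum>j. x^j / \<alpha>^(j + 1))\<close>.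
  For \<open>\<alpha> = 0\<close> and \<open>n = 0\<close> the value \<open>c / 0 = 0\<close> is the correct one.
\<close>

fun gpl_coeff :: "complex list \<Rightarrow> nat \<Rightarrow> complex" where
  "gpl_coeff [] n = (if n = 0 then 1 else 0)"
| "gpl_coeff (\<alpha> # \<alpha>s) n =
     (if \<alpha> = 0 then gpl_coeff \<alpha>s n / of_nat n
      else - (\<Sum>m<n. gpl_coeff \<alpha>s m / \<alpha> ^ (n - m)) / of_nat n)"

text \<open>Letters of norm 1 keep their poles outside the open unit disc, and a nonzero last letter
  excludes logarithms at 0. Both conditions pass to tails, as the induction on \<open>GPL\<close>
  requires.\<close>

definition zero_or_unit_list :: "complex list \<Rightarrow> bool" where
  "zero_or_unit_list \<alpha>s \<longleftrightarrow>
     (\<forall>\<alpha>\<in>set \<alpha>s. \<alpha> = 0 \<or> norm \<alpha> = 1) \<and> (\<alpha>s \<noteq> [] \<longrightarrow> last \<alpha>s \<noteq> 0)"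

text \<open>For a letter of norm 1, the sum has \<open>n\<close> terms of norm at most 1, and the
  division by \<open>n\<close> compensates for their number.\<close>

lemma norm_gpl_coeff_le:
  "\<forall>\<alpha>\<in>set \<alpha>s. \<alpha> = 0 \<or> norm \<alpha> = 1 \<Longrightarrow> norm (gpl_coeff \<alpha>s n) \<le> 1"
proof (induction \<alpha>s arbitrary: n)
  case (Cons \<alpha> \<alpha>s)
  have IH: "norm (gpl_coeff \<alpha>s m) \<le> 1" for m using Cons by simp
  show ?case
  proof (cases "n = 0")
    case False
    then have n: "real n \<ge> 1" by simp
    show ?thesis
    proof (cases "\<alpha> = 0")
      case True
      have "norm (gpl_coeff \<alpha>s n) \<le> real n" using IH[of n] n by linarith
      then show ?thesis using True n by (simp add: norm_divide)
    next
      case \<alpha>: False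
      then have "norm \<alpha> = 1" using Cons.prems by simp
      then have "norm (\<Sum>m<n. gpl_coeff \<alpha>s m / \<alpha> ^ (n - m)) \<le> (\<Sum>m<n. 1)"
        by (intro sum_norm_le) (simp add: norm_divide norm_power IH)
      then show ?thesis using \<alpha> n by (simp add: norm_divide)
    qed
  qed simp
qed simp

lemma summable_norm_powser_bounded_coeff:
  fixes c :: "nat \<Rightarrow> complex"
  assumes "\<And>n. norm (c n) \<le> 1" "norm z < 1"
  shows "summable (\<lambda>n. norm (c n * z ^ n))"
proof (rule summable_comparison_test')
  show "summable (\<lambda>n. norm z ^ n)" using assms(2) by (intro summable_geometric) simp
  show "norm (norm (c n * z ^ n)) \<le> norm z ^ n" for n
    using mult_right_mono[OF assms(1)[of n], of "norm z ^ n"] by (simp add: norm_mult norm_power)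
qed

text \<open>This and the next lemma compare coefficients in (z - \<alpha>) F'(z) = G(z), where F and
  G are the series of \<open>\<alpha> # \<alpha>s\<close> and \<open>\<alpha>s\<close>. The excluded
  case is the logarithm: it would require 0 = 1 here.\<close>

lemma gpl_coeff_diffs_0:
  assumes "\<alpha> \<noteq> 0 \<or> \<alpha>s \<noteq> []"
  shows "- \<alpha> * diffs (gpl_coeff (\<alpha> # \<alpha>s)) 0 = gpl_coeff \<alpha>s 0"
  using assms by (cases \<alpha>s) (auto simp: diffs_def)

lemma gpl_coeff_diffs_Suc:
  "diffs (gpl_coeff (\<alpha> # \<alpha>s)) k - \<alpha> * diffs (gpl_coeff (\<alpha> # \<alpha>s)) (Suc k) = gpl_coeff \<alpha>s (Suc k)"
proof (cases "\<alpha> = 0")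
  case False
  have "\<alpha> * (\<Sum>m<Suc k. gpl_coeff \<alpha>s m / \<alpha> ^ (Suc (Suc k) - m)) = (\<Sum>m<Suc k. gpl_coeff \<alpha>s m / \<alpha> ^ (Suc k - m))"
    unfolding sum_distrib_left
    by (intro sum.cong refl) (use False in \<open>simp add: Suc_diff_le\<close>)
  moreover have "\<alpha> * (\<Sum>m<Suc (Suc k). gpl_coeff \<alpha>s m / \<alpha> ^ (Suc (Suc k) - m)) =
     \<alpha> * (\<Sum>m<Suc k. gpl_coeff \<alpha>s m / \<alpha> ^ (Suc (Suc k) - m)) + gpl_coeff \<alpha>s (Suc k)"
    using False by (simp add: sum.lessThan_Suc[of _ "Suc k"] distrib_left del: sum.lessThan_Suc)
  moreover have e: "diffs (gpl_coeff (\<alpha> # \<alpha>s)) j = - (\<Sum>m<Suc j. gpl_coeff \<alpha>s m / \<alpha> ^ (Suc j - m))" for j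
    using False by (simp add: diffs_def del: of_nat_Suc sum.lessThan_Suc)
  ultimately show ?thesis unfolding e by (simp del: sum.lessThan_Suc)
qed (simp add: diffs_def del: of_nat_Suc)

text \<open>The differential equation is kept free of division so that it also covers z = \<alpha> =
  0.\<close>

lemma gpl_series_has_derivative:
  assumes "\<forall>\<beta>\<in>set (\<alpha> # \<alpha>s). \<beta> = 0 \<or> norm \<beta> = 1" "\<alpha> \<noteq> 0 \<or> \<alpha>s \<noteq> []" "norm z < 1"
  obtains D where "((\<lambda>z. \<Sum>n. gpl_coeff (\<alpha> # \<alpha>s) n * z ^ n) has_field_derivative D) (at z)"
    "(z - \<alpha>) * D = (\<Sum>n. gpl_coeff \<alpha>s n * z ^ n)"
proof -
  define e where "e = diffs (gpl_coeff (\<alpha> # \<alpha>s))"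
  have sm: "summable (\<lambda>n. gpl_coeff (\<alpha> # \<alpha>s) n * x ^ n)" if "norm x < 1" for x
    using assms(1) that
    by (intro summable_norm_cancel[OF summable_norm_powser_bounded_coeff] norm_gpl_coeff_le)
  define D where "D = (\<Sum>n. e n * z ^ n)"
  have der: "((\<lambda>z. \<Sum>n. gpl_coeff (\<alpha> # \<alpha>s) n * z ^ n) has_field_derivative D) (at z)"
    unfolding D_def e_def by (rule termdiffs_strong'[OF sm assms(3)])
  have e: "(\<lambda>n. e n * z ^ n) sums D"
    unfolding D_def e_def by (intro summable_sums termdiff_converges[OF assms(3)] sm)
  \<comment> \<open>The series of z F'(z): the derivative series shifted by one place, with constant
    term 0.\<close>
  define f where "f n = (case n of 0 \<Rightarrow> 0 | Suc k \<Rightarrow> e k * z ^ Suc k)" for n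
  have "(\<lambda>n. f (Suc n)) sums (z * D)"
    using sums_mult[OF e, of z] by (simp add: f_def mult_ac)
  then have "f sums (z * D)" by (subst (asm) sums_Suc_iff) (simp add: f_def)
  then have "(\<lambda>n. f n - \<alpha> * (e n * z ^ n)) sums (z * D - \<alpha> * D)"
    by (intro sums_diff sums_mult e)
  moreover have "f n - \<alpha> * (e n * z ^ n) = gpl_coeff \<alpha>s n * z ^ n" for n
  proof (cases n)
    case 0
    then show ?thesis using gpl_coeff_diffs_0[OF assms(2)] by (simp add: f_def e_def)
  next
    case (Suc k)
    have "f n - \<alpha> * (e n * z ^ n) = (e k - \<alpha> * e (Suc k)) * z ^ Suc k"
      by (simp add: f_def Suc algebra_simps)
    then show ?thesis unfolding e_def gpl_coeff_diffs_Suc by (simp add: Suc)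
  qed
  ultimately have "(\<lambda>n. gpl_coeff \<alpha>s n * z ^ n) sums ((z - \<alpha>) * D)"
    by (simp add: algebra_simps)
  then show ?thesis using that der by (simp add: sums_iff)
qed

text \<open>By induction, the series is a primitive of the integrand and vanishes at 0, so its value
  at \<open>z\<close> is the integral along the segment. The same computation gives
  integrability.\<close>

lemma GPL_eq_series:
  assumes "zero_or_unit_list \<alpha>s" "norm z < 1"
  shows "GPL \<alpha>s z = (\<Sum>n. gpl_coeff \<alpha>s n * z ^ n) \<and> GPL_convergent \<alpha>s z"
  using assms
proof (induction \<alpha>s arbitrary: z)
  case Nil
  have "(\<Sum>n. gpl_coeff [] n * z ^ n) = (\<Sum>n\<in>{0}. gpl_coeff [] n * z ^ n)"
    by (rule suminf_finite) auto
  then show ?case by simp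
next
  case (Cons \<alpha> \<alpha>s)
  define F where "F = (\<lambda>z. \<Sum>n. gpl_coeff (\<alpha> # \<alpha>s) n * z ^ n)"
  have ok: "\<forall>\<beta>\<in>set (\<alpha> # \<alpha>s). \<beta> = 0 \<or> norm \<beta> = 1" "\<alpha> \<noteq> 0 \<or> \<alpha>s \<noteq> []"
    using Cons.prems by (auto simp: zero_or_unit_list_def)
  have ok': "zero_or_unit_list \<alpha>s"
    using Cons.prems(1) by (auto simp: zero_or_unit_list_def split: if_splits)
  have nonzero: "\<not> (\<forall>\<beta>\<in>set (\<alpha> # \<alpha>s). \<beta> = 0)"
    using Cons.prems(1) last_in_set[of "\<alpha> # \<alpha>s"] unfolding zero_or_unit_list_def by blast
  have "\<exists>D. (F has_field_derivative D) (at x) \<and> (x - \<alpha>) * D = GPL \<alpha>s x"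
    if "norm x < 1" for x
    using gpl_series_has_derivative[OF ok that] Cons.IH[OF ok' that] unfolding F_def by metis
  then obtain F' where F': "\<And>x. norm x < 1 \<Longrightarrow> (F has_field_derivative F' x) (at x)"
      "\<And>x. norm x < 1 \<Longrightarrow> (x - \<alpha>) * F' x = GPL \<alpha>s x"
    by metis
  have seg: "norm x < 1" if "x \<in> closed_segment 0 z" for x
    using segment_bound(1)[OF that] Cons.prems(2) by simp
  have "F 0 = 0" by (simp add: F_def)
  then have "(F' has_contour_integral F z) (linepath 0 z)"
    using contour_integral_primitive[of "ball 0 1" F F' "linepath 0 z"] F'(1) seg
    by (simp add: has_field_derivative_at_within subset_eq)
  then have int: "((\<lambda>t. F' (linepath 0 z t) * z) has_integral F z) {0..1}"
    by (simp add: has_contour_integral_linepath)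
  have "((\<lambda>t. 1 / (linepath 0 z t - \<alpha>) * GPL \<alpha>s (linepath 0 z t) * z) has_integral F z) {0..1}"
  \<comment> \<open>For \<alpha> = 0 the integrand is 1 / 0 = 0 at the start of the path and may
    differ from F' there; a single point does not affect the integral.\<close>
  proof (rule has_integral_spike_finite[OF _ _ int])
    fix t :: real assume t: "t \<in> {0..1} - {0}"
    show "1 / (linepath 0 z t - \<alpha>) * GPL \<alpha>s (linepath 0 z t) * z = F' (linepath 0 z t) * z"
    proof (cases "z = 0")
      case False
      define x where "x = linepath 0 z t"
      have "x \<in> closed_segment 0 z"
        using t linepath_in_path[of t 0 z] by (simp add: x_def)
      then have x: "norm x < 1" by (rule seg)
      have "x \<noteq> 0" using t False by (simp add: x_def linepath_def)
      then have "x \<noteq> \<alpha>" using ok(1) x by auto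
      then have "1 / (x - \<alpha>) * GPL \<alpha>s x = F' x"
        using F'(2)[OF x] by (simp add: field_simps)
      then show ?thesis by (simp add: x_def)
    qed simp
  qed simp
  then have *: "((\<lambda>x. 1 / (x - \<alpha>) * GPL \<alpha>s x) has_contour_integral F z) (linepath 0 z)"
    by (simp add: has_contour_integral_linepath)
  have "GPL (\<alpha> # \<alpha>s) z = F z"
    using nonzero contour_integral_unique[OF *] by (simp only: GPL.simps if_False)
  moreover have "\<forall>x\<in>open_segment 0 z. GPL_convergent \<alpha>s x"
    using Cons.IH[OF ok'] seg by (auto simp: open_segment_def)
  then have "GPL_convergent (\<alpha> # \<alpha>s) z"
    using nonzero has_contour_integral_integrable[OF *] by (simp only: GPL_convergent.simps if_False)
  ultimately show ?case by (simp add: F_def)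
qed

text \<open>
  The translation \<open>Li\<^bsub>a\<^sub>1,\<dots>,a\<^sub>d\<^esub>(\<beta>\<^sub>0/\<beta>\<^sub>1, \<beta>\<^sub>1/\<beta>\<^sub>2, \<dots>) \<mapsto> G(0,\<dots>,0,\<beta>\<^sub>1,0,\<dots>,0,\<beta>\<^sub>2,\<dots>)\<close>, where \<open>\<beta>\<^sub>j\<close> is
  preceded by \<open>a\<^sub>j - 1\<close> zeros.
\<close>

fun word_alphas :: "complex \<Rightarrow> (nat \<times> complex) list \<Rightarrow> complex list" where
  "word_alphas \<beta> [] = []"
| "word_alphas \<beta> ((a, \<sigma>) # w) = replicate (a - 1) 0 @ \<beta> / \<sigma> # word_alphas (\<beta> / \<sigma>) w"

lemma gpl_coeff_replicate_0: "gpl_coeff (replicate k 0 @ \<alpha>s) n = gpl_coeff \<alpha>s n / of_nat n ^ k"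
  by (induction k) auto

lemma root_of_unity_nonzero: "N > 0 \<Longrightarrow> \<sigma> ^ N = 1 \<Longrightarrow> \<sigma> \<noteq> 0" for \<sigma> :: complex
  by (auto simp: power_0_left)

lemma norm_root_of_unity:
  assumes "N > 0" "\<sigma> ^ N = 1"
  shows "norm (\<sigma> :: complex) = 1"
  using power_eq_1_iff[OF assms(2)] assms(1) by simp

text \<open>Each letter contributes one sign, from the expansion of 1 / (x - \<gamma>) with \<gamma>
  = \<beta> / \<sigma>. The inner power \<gamma>^(-m) cancels, and the remaining \<gamma>^(-n) =
  \<sigma>^n / \<beta>^n supplies the factor \<sigma>^n of the word.\<close>

lemma gpl_coeff_word_alphas:
  assumes "w \<in> root_words N K" "N > 0" "\<beta> \<noteq> 0"
  shows "gpl_coeff (word_alphas \<beta> w) n = (-1) ^ length w * word_coeff w n / \<beta> ^ n"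
  using assms(1,3)
proof (induction w arbitrary: \<beta> n K)
  case (Cons x w)
  obtain a \<sigma> where x: "x = (a, \<sigma>)" by (cases x)
  with Cons.prems obtain K' where w: "a \<ge> 1" "\<sigma> ^ N = 1" "w \<in> root_words N K'"
    by (auto simp: root_words_Cons)
  have \<sigma>: "\<sigma> \<noteq> 0" using root_of_unity_nonzero assms(2) w by blast
  define \<gamma> where "\<gamma> = \<beta> / \<sigma>"
  have \<gamma>: "\<gamma> \<noteq> 0" using \<sigma> Cons.prems by (simp add: \<gamma>_def)
  have "(\<Sum>m<n. gpl_coeff (word_alphas \<gamma> w) m / \<gamma> ^ (n - m)) = (\<Sum>m<n. (-1) ^ length w * word_coeff w m / \<gamma> ^ n)"
  proof (rule sum.cong)
    fix m assume "m \<in> {..<n}"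
    then have "\<gamma> ^ n = \<gamma> ^ m * \<gamma> ^ (n - m)" by (simp flip: power_add)
    then show "gpl_coeff (word_alphas \<gamma> w) m / \<gamma> ^ (n - m) = (-1) ^ length w * word_coeff w m / \<gamma> ^ n"
      using Cons.IH[OF w(3) \<gamma>] by simp
  qed simp
  also have "\<dots> = (-1) ^ length w * (\<Sum>m<n. word_coeff w m) * \<sigma> ^ n / \<beta> ^ n"
    by (simp add: \<gamma>_def power_divide sum_distrib_left sum_distrib_right sum_divide_distrib)
  finally have "gpl_coeff (\<gamma> # word_alphas \<gamma> w) n =
      - ((-1) ^ length w * (\<Sum>m<n. word_coeff w m) * \<sigma> ^ n / \<beta> ^ n) / of_nat n"
    using \<gamma> by simp
  moreover have "of_nat n ^ a = (of_nat n * of_nat n ^ (a - 1) :: complex)"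
    using w(1) by (simp flip: power_Suc)
  ultimately show ?case
    by (simp add: x \<gamma>_def[symmetric] gpl_coeff_replicate_0 mult_ac del: gpl_coeff.simps)
qed simp

lemma word_alphas_props:
  assumes "w \<in> root_words N K" "\<beta> ^ N = 1"
  shows "length (word_alphas \<beta> w) = K" "\<forall>\<alpha>\<in>set (word_alphas \<beta> w). \<alpha> = 0 \<or> \<alpha> ^ N = 1"
    "w \<noteq> [] \<Longrightarrow> last (word_alphas \<beta> w) ^ N = 1"
proof -
  have "length (word_alphas \<beta> w) = K \<and> (\<forall>\<alpha>\<in>set (word_alphas \<beta> w). \<alpha> = 0 \<or> \<alpha> ^ N = 1) \<and>
      (w \<noteq> [] \<longrightarrow> word_alphas \<beta> w \<noteq> [] \<and> last (word_alphas \<beta> w) ^ N = 1)"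
    using assms
  proof (induction w arbitrary: \<beta> K)
    case Nil
    then show ?case by (simp add: root_words_def)
  next
    case (Cons x w)
    obtain a \<sigma> where x: "x = (a, \<sigma>)" by (cases x)
    with Cons.prems obtain K' where w: "a \<ge> 1" "\<sigma> ^ N = 1" "K = a + K'" "w \<in> root_words N K'"
      by (auto simp: root_words_Cons)
    have "(\<beta> / \<sigma>) ^ N = 1" using w Cons.prems by (simp add: power_divide)
    then show ?case using Cons.IH[OF w(4), of "\<beta> / \<sigma>"] w(1,3)
      by (cases w) (auto simp: x)
  qed
  then show "length (word_alphas \<beta> w) = K" "\<forall>\<alpha>\<in>set (word_alphas \<beta> w). \<alpha> = 0 \<or> \<alpha> ^ N = 1"
    "w \<noteq> [] \<Longrightarrow> last (word_alphas \<beta> w) ^ N = 1" by auto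
qed

text \<open>At \<beta> = 1 the coefficient agrees with \<open>gpl_coeff\<close> up to sign. The
  bound gives absolute convergence of the word series in the unit disc.\<close>

lemma norm_word_coeff_le:
  assumes "w \<in> root_words N K" "N > 0"
  shows "norm (word_coeff w n) \<le> 1"
proof -
  have "norm (gpl_coeff (word_alphas 1 w) n) \<le> 1"
    using word_alphas_props(2)[OF assms(1), of 1] norm_root_of_unity[OF assms(2)]
    by (intro norm_gpl_coeff_le) auto
  then show ?thesis
    using gpl_coeff_word_alphas[OF assms, of 1 n] by (simp add: norm_mult norm_power)
qed

lemma GPL_word_alphas:
  assumes "w \<in> root_words N K" "N > 0" "norm z < 1"
  shows "GPL (word_alphas 1 w) z = (-1) ^ length w * (\<Sum>n. word_coeff w n * z ^ n)"
    "GPL_convergent (word_alphas 1 w) z"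
proof -
  have ok: "zero_or_unit_list (word_alphas 1 w)"
    using word_alphas_props[OF assms(1), of 1] norm_root_of_unity[OF assms(2)]
      root_of_unity_nonzero[OF assms(2)]
    by (cases "w = []") (auto simp: zero_or_unit_list_def)
  have "(\<lambda>n. word_coeff w n * z ^ n) sums (\<Sum>n. word_coeff w n * z ^ n)"
    using norm_word_coeff_le[OF assms(1,2)] assms(3)
    by (intro summable_sums summable_norm_cancel[OF summable_norm_powser_bounded_coeff])
  from sums_mult[OF this, of "(-1) ^ length w"]
  show "GPL (word_alphas 1 w) z = (-1) ^ length w * (\<Sum>n. word_coeff w n * z ^ n)"
    using GPL_eq_series[OF ok assms(3)] gpl_coeff_word_alphas[OF assms(1,2), of 1]
    by (simp add: sums_iff mult.assoc)
  show "GPL_convergent (word_alphas 1 w) z" using GPL_eq_series[OF ok assms(3)] by simp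
qed

lemma word_series_in_GG:
  assumes "w \<in> root_words N K" "N > 0" "K > 0" "norm z < 1"
  shows "(\<Sum>n. word_coeff w n * z ^ n) \<in> \<GG> z K N"
proof -
  have ne: "w \<noteq> []" using assms(1,3) by (auto simp: root_words_def)
  have "GPL (word_alphas 1 w) z \<in> \<GG> z K N"
    using assms(3) word_alphas_props[OF assms(1), of 1] ne GPL_word_alphas(2)[OF assms(1,2,4)]
    by (auto simp: \<GG>_def intro!: Q.span_base exI[of _ "word_alphas 1 w"] dest: in_set_butlastD)
  then have "rat_scale ((-1) ^ length w) (GPL (word_alphas 1 w) z) \<in> \<GG> z K N"
    using assms(3) by (simp add: \<GG>_def Q.span_scale)
  \<comment> \<open>The sign is its own inverse, so it can be moved to the side of
    \<open>GPL\<close>.\<close>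
  moreover have "(-1) ^ length w * ((-1) ^ length w * x) = x" for x :: complex
    by (simp flip: mult.assoc power_add)
  ultimately show ?thesis
    by (simp add: rat_scale_def of_rat_power GPL_word_alphas(1)[OF assms(1,2,4)])
qed

section \<open>Comparison of G and L for N = 1\<close>

text \<open>Reading from the right, a 0 raises the exponent of the current first letter and a 1
  opens a new letter. Hence for N = 1 every generator of \<open>\<GG>\<close> comes from a
  word.\<close>

lemma zero_one_list_eq_word_alphas:
  assumes "\<forall>\<alpha>\<in>set \<alpha>s. \<alpha> = 0 \<or> \<alpha> = 1" "\<alpha>s \<noteq> []" "last \<alpha>s = 1"
  shows "\<exists>w \<in> root_words 1 (length \<alpha>s). \<alpha>s = word_alphas 1 w"
  using assms
proof (induction \<alpha>s)
  case (Cons \<alpha> \<alpha>s)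
  show ?case
  proof (cases "\<alpha>s = []")
    case True
    then show ?thesis using Cons.prems
      by (intro bexI[of _ "[(1, 1)]"]) (auto simp: root_words_def)
  next
    case False
    with Cons obtain w where w: "w \<in> root_words 1 (length \<alpha>s)" "\<alpha>s = word_alphas 1 w" by auto
    show ?thesis
    proof (cases "\<alpha> = 0")
      case True
      obtain a \<sigma> v K' where v: "w = (a, \<sigma>) # v" "a \<ge> 1" "\<sigma> ^ 1 = 1" "v \<in> root_words 1 K'" "length \<alpha>s = a + K'"
        by (rule root_words_Cons_cases[OF w(1)]) (use False in auto)
      then show ?thesis using True w(2)
        by (intro bexI[of _ "(Suc a, \<sigma>) # v"]) (auto simp: root_words_Cons simp flip: replicate_Suc)
    next
      case False
      then show ?thesis using Cons.prems w
        by (intro bexI[of _ "(1, 1) # w"]) (auto simp: root_words_Cons)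
    qed
  qed
qed simp

lemma L_polylog_eq_word_series:
  assumes "\<forall>a\<in>set as. a \<ge> 1" "as \<noteq> []" "norm z < 1"
  shows "L_polylog as z = (\<Sum>n. word_coeff (map (\<lambda>b. (b, 1)) as) n * z ^ n)"
proof -
  obtain a bs where as: "as = a # bs" using assms(2) by (cases as) auto
  define w where "w = map (\<lambda>b. (b, 1::complex)) as"
  have w: "w \<in> root_words 1 (sum_list as)"
    using assms(1) by (auto simp: w_def root_words_def comp_def)
  define S where "S = (\<Sum>n. word_coeff w n * z ^ n)"
  have "(\<lambda>n. word_coeff w n * z ^ n) sums S"
    unfolding S_def using norm_word_coeff_le[OF w] assms(3)
    by (intro summable_sums summable_norm_cancel[OF summable_norm_powser_bounded_coeff]) auto
  \<comment> \<open>The power z^n is absorbed into the first letter, so the truncated sums of L are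
    the partial sums of this power series.\<close>
  moreover have "(\<lambda>n. word_coeff w n * z ^ n) = word_coeff ((a, z) # map (\<lambda>b. (b, 1)) bs)"
    by (simp add: w_def as fun_eq_iff)
  ultimately have "word_sum ((a, z) # map (\<lambda>b. (b, 1)) bs) \<longlonglongrightarrow> S"
    unfolding word_sum_def[abs_def] by (simp only: sums_def_le)
  moreover have "L_partial as z = word_sum ((a, z) # map (\<lambda>b. (b, 1)) bs)"
    by (simp add: as L_partial_eq_word_sum fun_eq_iff)
  ultimately show ?thesis by (simp add: L_polylog_def w_def S_def limI)
qed

lemma L_polylogs_eq_word_series:
  assumes "K > 0" "norm z < 1"
  shows "{L_polylog as z | as. (\<forall>a\<in>set as. a \<ge> 1) \<and> sum_list as = K} =
    (\<lambda>w. \<Sum>n. word_coeff w n * z ^ n) ` root_words 1 K" (is "?A = ?B")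
proof
  show "?A \<subseteq> ?B"
  proof
    fix x assume "x \<in> ?A"
    then obtain as where as: "x = L_polylog as z" "\<forall>a\<in>set as. a \<ge> 1" "sum_list as = K" by auto
    then have "map (\<lambda>b. (b, 1)) as \<in> root_words 1 K" by (auto simp: root_words_def comp_def)
    moreover have "as \<noteq> []" using as assms by auto
    ultimately show "x \<in> ?B" using L_polylog_eq_word_series[OF as(2) _ assms(2)] as(1) by auto
  qed
  show "?B \<subseteq> ?A"
  proof
    fix x assume "x \<in> ?B"
    then obtain w where w: "x = (\<Sum>n. word_coeff w n * z ^ n)" "w \<in> root_words 1 K" by auto
    define as where "as = map fst w"
    have as: "\<forall>a\<in>set as. a \<ge> 1" "sum_list as = K" "as \<noteq> []"
      using w(2) assms by (auto simp: as_def root_words_def)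
    \<comment> \<open>A first root of unity is 1, so a word for N = 1 is recovered from its
      exponents.\<close>
    have "map (\<lambda>b. (b, 1)) as = map id w"
      unfolding as_def map_map using w(2) by (intro map_cong) (auto simp: root_words_def)
    then have "x = L_polylog as z"
      using L_polylog_eq_word_series[OF as(1,3) assms(2)] w(1) by simp
    then show "x \<in> ?A" using as by blast
  qed
qed

text \<open>Both sets of generators consist of the same word series up to sign, and signs are
  rational scalars.\<close>

lemma L_polylog_span_eq_GG:
  assumes "K > 0" "norm z < 1"
  shows "rat_span {L_polylog as z | as. (\<forall>a\<in>set as. a \<ge> 1) \<and> sum_list as = K} = \<GG> z K 1"
    (is "rat_span ?A = _")
proof
  have "Q.subspace (\<GG> z K 1)" using assms(1) by (simp add: \<GG>_def)
  then show "rat_span ?A \<subseteq> \<GG> z K 1"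
    unfolding L_polylogs_eq_word_series[OF assms]
    using assms by (intro Q.span_minimal) (auto intro: word_series_in_GG)
  have "GPL \<alpha>s z \<in> rat_span ?A"
    if \<alpha>s: "length \<alpha>s = K" "\<forall>\<alpha>\<in>set (butlast \<alpha>s). \<alpha> = 0 \<or> \<alpha> ^ 1 = 1" "last \<alpha>s ^ 1 = 1" for \<alpha>s
  proof -
    have ne: "\<alpha>s \<noteq> []" using \<alpha>s assms(1) by auto
    have "set \<alpha>s = insert (last \<alpha>s) (set (butlast \<alpha>s))"
      using arg_cong[OF append_butlast_last_id[OF ne], of set] by simp
    then have "\<forall>\<alpha>\<in>set \<alpha>s. \<alpha> = 0 \<or> \<alpha> = 1" using \<alpha>s by auto
    then obtain w where w: "w \<in> root_words 1 K" "\<alpha>s = word_alphas 1 w"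
      using zero_one_list_eq_word_alphas[OF _ ne] \<alpha>s by auto
    have "rat_scale ((-1) ^ length w) (\<Sum>n. word_coeff w n * z ^ n) \<in> rat_span ?A"
      unfolding L_polylogs_eq_word_series[OF assms] using w(1)
      by (intro Q.span_scale Q.span_base imageI)
    then show ?thesis
      using GPL_word_alphas(1)[OF w(1) _ assms(2)] w(2) by (simp add: rat_scale_def of_rat_power)
  qed
  then have "{GPL \<alpha>s z | \<alpha>s. length \<alpha>s = K \<and> (\<forall>\<alpha>\<in>set (butlast \<alpha>s). \<alpha> = 0 \<or> \<alpha> ^ 1 = 1) \<and>
      last \<alpha>s ^ 1 = 1 \<and> GPL_convergent \<alpha>s z} \<subseteq> rat_span ?A" by blast
  from Q.span_minimal[OF this Q.subspace_span] show "\<GG> z K 1 \<subseteq> rat_span ?A"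
    using assms(1) by (simp add: \<GG>_def)
qed

section \<open>Generating functions of word sums\<close>

text \<open>Passing from coefficients to their partial sums multiplies the generating function by
  the geometric series.\<close>

lemma word_sum_power_series:
  assumes "w \<in> root_words N K" "N > 0" "K > 0" "norm z < 1"
  shows "(\<lambda>n. word_sum w (Suc n) * z ^ Suc n) sums ((\<Sum>n. word_coeff w n * z ^ n) / (1 - z))"
proof -
  have "(\<lambda>k. \<Sum>i\<le>k. (word_coeff w i * z ^ i) * z ^ (k - i)) sums
      ((\<Sum>n. word_coeff w n * z ^ n) * (\<Sum>n. z ^ n))"
    using norm_word_coeff_le[OF assms(1,2)] assms(4)
    by (intro Cauchy_product_sums summable_norm_powser_bounded_coeff)
       (auto simp: norm_power summable_geometric)
  moreover have "(\<Sum>i\<le>k. (word_coeff w i * z ^ i) * z ^ (k - i)) = word_sum w k * z ^ k" for k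
    by (simp add: word_sum_def sum_distrib_right mult.assoc flip: power_add)
  moreover have "(\<Sum>n. z ^ n) = 1 / (1 - z)"
    using assms(4) by (rule suminf_geometric)
  \<comment> \<open>Positive weight excludes the empty word, so the term at index 0 vanishes and
    summation may start at 1.\<close>
  moreover have "w \<noteq> []" using assms(1,3) by (auto simp: root_words_def)
  then have "word_sum w 0 = 0" by (cases w) auto
  ultimately show ?thesis by (subst sums_Suc_iff) simp
qed

lemma word_span_power_series:
  assumes "f \<in> word_span N K" "N > 0" "K > 0" "norm z < 1"
  shows "summable (\<lambda>n. f (Suc n) * z ^ Suc n)"
    "(\<Sum>n. f (Suc n) * z ^ Suc n) \<in> (\<lambda>v. v / (1 - z)) ` \<GG> z K N"
proof -
  have z: "1 - z \<noteq> 0" using assms(4) by auto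
  \<comment> \<open>The preimage of \<open>\<GG>\<close> under multiplication by 1 - z, a subspace
    suitable for \<open>seq_span_suminf\<close>.\<close>
  define V where "V = {x. (1 - z) * x \<in> \<GG> z K N}"
  have "Q.subspace (\<GG> z K N)" using assms(3) by (simp add: \<GG>_def)
  then have V: "Q.subspace V"
    unfolding Q.subspace_def V_def rat_scale_def by (auto simp: distrib_left mult.left_commute)
  have *: "summable (\<lambda>n. f (Suc n) * z ^ Suc n) \<and> (\<Sum>n. f (Suc n) * z ^ Suc n) \<in> V"
    using assms(1) V
  proof (rule seq_span_suminf)
    fix g assume "g \<in> word_sum ` root_words N K"
    then obtain w where w: "w \<in> root_words N K" "g = word_sum w" by auto
    show "summable (\<lambda>n. g (Suc n) * z ^ Suc n) \<and> (\<Sum>n. g (Suc n) * z ^ Suc n) \<in> V"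
      using word_sum_power_series[OF w(1) assms(2-4)] word_series_in_GG[OF w(1) assms(2-4)] z
      by (simp add: sums_iff w(2) V_def)
  qed
  then show "summable (\<lambda>n. f (Suc n) * z ^ Suc n)" by blast
  show "(\<Sum>n. f (Suc n) * z ^ Suc n) \<in> (\<lambda>v. v / (1 - z)) ` \<GG> z K N"
    using * z by (intro image_eqI[where x = "(1 - z) * (\<Sum>n. f (Suc n) * z ^ Suc n)"])
      (simp_all add: V_def)
qed

section \<open>Convergence at roots of unity\<close>

text \<open>Roots of unity have norm 1 and exponents are at least 1. Bounding every inner sum by its
  value up to \<open>n\<close> decouples the nested sums.\<close>

lemma norm_word_sum_le_harm:
  assumes "w \<in> root_words N K" "N > 0"
  shows "norm (word_sum w n) \<le> harm n ^ length w"
  using assms(1)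
proof (induction w arbitrary: n K)
  case (Cons x w)
  obtain a \<sigma> where x: "x = (a, \<sigma>)" by (cases x)
  with Cons.prems obtain K' where w: "a \<ge> 1" "\<sigma> ^ N = 1" "w \<in> root_words N K'"
    by (auto simp: root_words_Cons)
  have "norm (word_sum (x # w) n) \<le> (\<Sum>l=1..n. inverse (real l) * harm n ^ length w)"
    unfolding x word_sum_Cons
  proof (rule sum_norm_le)
    fix l assume l: "l \<in> {1..n}"
    have "real l ^ 1 \<le> real l ^ a" using l w(1) by (intro power_increasing) auto
    then have "1 / real l ^ a \<le> inverse (real l)" using l by (simp add: field_simps)
    moreover have "norm (word_sum w (l - 1)) \<le> harm n ^ length w"
      using Cons.IH[OF w(3), of "l - 1"] l
      by (elim order_trans) (auto intro!: power_mono harm_mono harm_nonneg)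
    ultimately show "norm (\<sigma> ^ l / of_nat l ^ a * word_sum w (l - 1)) \<le> inverse (real l) * harm n ^ length w"
      using norm_root_of_unity[OF assms(2) w(2)]
      by (auto simp: norm_mult norm_divide norm_power norm_inverse divide_inverse intro!: mult_mono)
  qed
  also have "\<dots> = harm n ^ length (x # w)"
    by (simp add: harm_def sum_distrib_right)
  finally show ?case .
qed simp

text \<open>The difference \<open>harm n - ln n\<close> decreases from its value 1 at n = 1.\<close>

lemma harm_le_ln: "n > 0 \<Longrightarrow> harm n \<le> 1 + ln (real n)"
  using decseqD[OF decseq_harm_diff_ln, of 0 "n - 1"] by (simp add: harm_def)

lemma harm_power_le_sqrt: "\<exists>C. \<forall>n. harm n ^ d \<le> C * sqrt (real (Suc n))"
proof -
  \<comment> \<open>Since ln x \<le> x^a / a for every a > 0, the d-th power grows at most like x^(a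
    d); this choice keeps a d below 1/2.\<close>
  define a where "a = 1 / (2 * real (Suc d))"
  have a: "a > 0" "a * real d \<le> 1 / 2" by (simp_all add: a_def field_simps)
  have "harm n ^ d \<le> (1 + 1 / a) ^ d * sqrt (real (Suc n))" for n
  proof -
    define x where "x = real (Suc n)"
    have x: "x \<ge> 1" by (simp add: x_def)
    have "harm n \<le> (harm (Suc n) :: real)" by (intro harm_mono) simp
    also have "\<dots> \<le> 1 + ln x" unfolding x_def by (rule harm_le_ln) simp
    also have "\<dots> \<le> x powr a + x powr a / a"
      using ln_powr_bound[OF x a(1)] ge_one_powr_ge_zero[OF x, of a] a by simp
    finally have "harm n \<le> (1 + 1 / a) * x powr a" by (simp add: algebra_simps)
    from power_mono[OF this harm_nonneg, of d]
    have "harm n ^ d \<le> (1 + 1 / a) ^ d * (x powr a) ^ d" by (simp add: power_mult_distrib)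
    also have "(x powr a) ^ d = x powr (a * real d)"
      using x by (simp add: powr_powr flip: powr_realpow)
    also have "(1 + 1 / a) ^ d * x powr (a * real d) \<le> (1 + 1 / a) ^ d * x powr (1 / 2)"
      using a x by (intro mult_left_mono powr_mono) auto
    also have "x powr (1 / 2) = sqrt x" using x by (simp add: powr_half_sqrt)
    finally show ?thesis unfolding x_def .
  qed
  then show ?thesis by blast
qed

lemma norm_word_sum_le_sqrt:
  assumes "w \<in> root_words N K" "N > 0"
  obtains C where "C \<ge> 0" "\<And>n. norm (word_sum w n) \<le> C * sqrt (real (Suc n))"
proof -
  obtain C where C: "\<And>n. harm n ^ length w \<le> C * sqrt (real (Suc n))"
    using harm_power_le_sqrt by blast
  have "norm (word_sum w n) \<le> C * sqrt (real (Suc n))" for n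
    using norm_word_sum_le_harm[OF assms, of n] C[of n] by linarith
  moreover have "C \<ge> 0" using order_trans[OF zero_le_power[OF harm_nonneg] C[of 0]] by simp
  ultimately show ?thesis using that by blast
qed

lemma summable_sqrt_over_square: "summable (\<lambda>n. sqrt (real (Suc n)) / real (Suc n) ^ 2)"
proof -
  have "sqrt (real (Suc n)) / real (Suc n) ^ 2 = real (Suc n) powr (-3/2)" for n
  proof -
    have "real (Suc n) powr (-3/2) = real (Suc n) powr (1/2 - 2)" by simp
    also have "\<dots> = sqrt (real (Suc n)) / real (Suc n) ^ 2"
      unfolding powr_diff by (simp add: powr_half_sqrt del: of_nat_Suc)
    finally show ?thesis by simp
  qed
  moreover have "summable (\<lambda>n. real (Suc n) powr (-3/2))"
    by (subst summable_Suc_iff) (simp add: summable_real_powr_iff)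
  ultimately show ?thesis by simp
qed

text \<open>The square-root growth of the inner sum leaves terms of order n^(-3/2), so the
  convergence is absolute.\<close>

lemma summable_word_coeff_Cons_ge_2:
  assumes "w \<in> root_words N K" "N > 0" "b \<ge> 2" "\<tau> ^ N = 1"
  shows "summable (\<lambda>n. word_coeff ((b, \<tau>) # w) (Suc n))"
proof -
  obtain C where C: "C \<ge> 0" "\<And>n. norm (word_sum w n) \<le> C * sqrt (real (Suc n))"
    using norm_word_sum_le_sqrt[OF assms(1,2)] by blast
  show ?thesis
  proof (rule summable_comparison_test')
    show "summable (\<lambda>n. C * (sqrt (real (Suc n)) / real (Suc n) ^ 2))"
      by (intro summable_mult summable_sqrt_over_square)
    fix n
    have "real (Suc n) ^ 2 \<le> real (Suc n) ^ b" using assms(3) by (intro power_increasing) auto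
    then have "norm (word_sum w n) / real (Suc n) ^ b \<le> C * sqrt (real (Suc n)) / real (Suc n) ^ 2"
      using C by (intro frac_le) auto
    then show "norm (word_coeff ((b, \<tau>) # w) (Suc n)) \<le> C * (sqrt (real (Suc n)) / real (Suc n) ^ 2)"
      unfolding word_coeff_Cons_Suc norm_mult norm_divide norm_power
      by (simp add: norm_root_of_unity[OF assms(2,4)] del: of_nat_Suc)
  qed
qed

text \<open>Summation by parts: twice the alternating sum of \<open>f\<close> is the alternating sum
  of its differences plus two boundary terms, one constant and one tending to 0.\<close>

lemma summable_alternating_bounded_variation:
  fixes f :: "nat \<Rightarrow> complex"
  assumes "f \<longlonglongrightarrow> 0" "summable (\<lambda>n. norm (f n - f (Suc n)))"
  shows "summable (\<lambda>n. (-1) ^ n * f n)"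
proof -
  have "summable (\<lambda>n. (-1) ^ n * (f n - f (Suc n)))"
    by (rule summable_norm_cancel) (use assms(2) in \<open>simp add: norm_mult norm_power\<close>)
  then obtain D where "(\<lambda>m. \<Sum>n<m. (-1) ^ n * (f n - f (Suc n))) \<longlonglongrightarrow> D"
    by (auto simp: summable_def sums_def)
  moreover have "(\<lambda>m. (-1) ^ m * f m) \<longlonglongrightarrow> 0"
    by (rule tendsto_norm_zero_cancel) (use tendsto_norm_zero[OF assms(1)] in \<open>simp add: norm_mult norm_power\<close>)
  ultimately have "(\<lambda>m. ((\<Sum>n<m. (-1) ^ n * (f n - f (Suc n))) + f 0 - (-1) ^ m * f m) / 2)
      \<longlonglongrightarrow> (D + f 0 - 0) / 2"
    by (intro tendsto_intros) auto
  moreover have "(\<Sum>n<m. (-1) ^ n * f n) =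
      ((\<Sum>n<m. (-1) ^ n * (f n - f (Suc n))) + f 0 - (-1) ^ m * f m) / 2" for m
    by (induction m) (auto simp: field_simps)
  ultimately have "(\<lambda>m. \<Sum>n<m. (-1) ^ n * f n) \<longlonglongrightarrow> (D + f 0 - 0) / 2"
    by presburger
  then show ?thesis unfolding summable_def sums_def by blast
qed

text \<open>With exponent 1 absolute convergence may fail, so the alternating criterion is applied
  to \<open>f\<close>, the word sum divided by n + 1.\<close>

lemma summable_word_coeff_Cons_alternating:
  assumes "w \<in> root_words N K" "N > 0"
  shows "summable (\<lambda>n. word_coeff ((1, -1) # w) (Suc n))"
proof -
  define f where "f n = word_sum w n / of_nat (Suc n)" for n
  obtain C where C: "C \<ge> 0" "\<And>n. norm (word_sum w n) \<le> C * sqrt (real (Suc n))"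
    using norm_word_sum_le_sqrt[OF assms(1,2)] by blast
  \<comment> \<open>The increments of the word sum are of order n^(-1/2); for the empty word they
    are 0.\<close>
  have "\<exists>C'\<ge>0. \<forall>n. norm (word_coeff w (Suc n)) \<le> C' * sqrt (real (Suc n)) / real (Suc n)"
  proof (cases w)
    case Nil
    then show ?thesis by (intro exI[of _ 0]) simp
  next
    case (Cons x v)
    obtain a \<sigma> where x: "x = (a, \<sigma>)" by (cases x)
    with Cons assms obtain K' where v: "a \<ge> 1" "\<sigma> ^ N = 1" "v \<in> root_words N K'"
      by (auto simp: root_words_Cons)
    obtain C' where C': "C' \<ge> 0" "\<And>n. norm (word_sum v n) \<le> C' * sqrt (real (Suc n))"
      using norm_word_sum_le_sqrt[OF v(3) assms(2)] by blast
    have "norm (word_coeff w (Suc n)) \<le> C' * sqrt (real (Suc n)) / real (Suc n)" for n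
    proof -
      have "real (Suc n) ^ 1 \<le> real (Suc n) ^ a" using v(1) by (intro power_increasing) auto
      then have "norm (word_sum v n) / real (Suc n) ^ a \<le> C' * sqrt (real (Suc n)) / real (Suc n)"
        using C' by (intro frac_le) auto
      then show ?thesis
        unfolding Cons x word_coeff_Cons_Suc norm_mult norm_divide norm_power
        by (simp add: norm_root_of_unity[OF assms(2) v(2)] del: of_nat_Suc)
    qed
    then show ?thesis using C'(1) by blast
  qed
  then obtain C' where C': "C' \<ge> 0"
    "\<And>n. norm (word_coeff w (Suc n)) \<le> C' * sqrt (real (Suc n)) / real (Suc n)" by blast
  have "f \<longlonglongrightarrow> 0"
  proof (rule Lim_null_comparison)
    show "\<forall>\<^sub>F n in sequentially. norm (f n) \<le> C * (1 / sqrt (real (Suc n)))"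
    proof (intro always_eventually allI)
      fix n
      have "norm (f n) \<le> C * sqrt (real (Suc n)) / real (Suc n)"
        unfolding f_def norm_divide norm_of_nat by (intro divide_right_mono C) simp
      also have "\<dots> = C * (1 / sqrt (real (Suc n)))"
        using real_sqrt_mult_self[of "real (Suc n)"] by (simp add: divide_simps del: of_nat_Suc)
      finally show "norm (f n) \<le> C * (1 / sqrt (real (Suc n)))" .
    qed
    have "filterlim (\<lambda>n. sqrt (real (Suc n))) at_top sequentially"
      by (intro filterlim_compose[OF sqrt_at_top] filterlim_compose[OF filterlim_real_sequentially filterlim_Suc])
    then have "(\<lambda>n. 1 / sqrt (real (Suc n))) \<longlonglongrightarrow> 0"
      by (intro tendsto_divide_0[OF tendsto_const] filterlim_at_top_imp_at_infinity)
    then show "(\<lambda>n. C * (1 / sqrt (real (Suc n)))) \<longlonglongrightarrow> 0"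
      by (rule tendsto_mult_right_zero)
  qed
  moreover have "summable (\<lambda>n. norm (f n - f (Suc n)))"
  proof (rule summable_comparison_test')
    show "summable (\<lambda>n. (C + C') * (sqrt (real (Suc n)) / real (Suc n) ^ 2))"
      by (intro summable_mult summable_sqrt_over_square)
    fix n
    define x where "x = real (Suc n)"
    have x: "x > 0" by (simp add: x_def)
    \<comment> \<open>Discrete product rule: one term comes from the change of the denominator, the
      other from the increment of the word sum. Both are of order n^(-3/2).\<close>
    have "f n - f (Suc n) = word_sum w n * of_real (1 / (x * (x + 1))) - word_coeff w (Suc n) * of_real (1 / (x + 1))"
    proof -
      have "A / y - (A + B) / (y + 1) = A * (1 / (y * (y + 1))) - B * (1 / (y + 1))"
        if "y \<noteq> 0" "y + 1 \<noteq> 0" for A B y :: complex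
        using that by (simp add: divide_simps) (simp add: algebra_simps)
      moreover have y: "of_nat (Suc n) = complex_of_real x" "of_nat (Suc (Suc n)) = complex_of_real x + 1"
        by (simp_all add: x_def)
      moreover have "complex_of_real x \<noteq> 0" "complex_of_real x + 1 \<noteq> 0"
        using y of_nat_neq_0 by metis+
      ultimately show ?thesis
        unfolding f_def word_sum_Suc y by simp
    qed
    then have "norm (f n - f (Suc n)) \<le> norm (word_sum w n) * (1 / (x * (x + 1))) + norm (word_coeff w (Suc n)) * (1 / (x + 1))"
      using x norm_triangle_ineq4[of "word_sum w n * of_real (1 / (x * (x + 1)))"
          "word_coeff w (Suc n) * of_real (1 / (x + 1))"]
      by (simp add: norm_mult del: of_real_divide of_real_add of_real_mult)
    also have "\<dots> \<le> (C * sqrt x) * (1 / x ^ 2) + (C' * sqrt x / x) * (1 / x)"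
      using C(2)[of n, folded x_def] C'(2)[of n, folded x_def] C(1) C'(1) x
      by (intro add_mono mult_mono) (auto simp: power2_eq_square intro!: divide_left_mono mult_left_mono)
    also have "\<dots> = (C + C') * (sqrt x / x ^ 2)"
      using x by (simp add: field_simps power2_eq_square)
    finally show "norm (norm (f n - f (Suc n))) \<le> (C + C') * (sqrt (real (Suc n)) / real (Suc n) ^ 2)"
      by (simp add: x_def)
  qed
  ultimately have "summable (\<lambda>n. - ((-1) ^ n * f n))"
    by (intro summable_minus summable_alternating_bounded_variation)
  moreover have "word_coeff ((1, -1) # w) (Suc n) = - ((-1) ^ n * f n)" for n
    unfolding word_coeff_Cons_Suc f_def by simp
  ultimately show ?thesis by simp
qed

section \<open>Series with values in \<ZZ>\<close>

lemma suminf_word_coeff_in_ZZ: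
  assumes "u \<in> root_words N K" "K > 0" "summable (\<lambda>n. word_coeff u (Suc n))"
  shows "(\<Sum>n. word_coeff u (Suc n)) \<in> \<ZZ> K N"
proof -
  have "u \<noteq> []" using assms(1,2) by (auto simp: root_words_def)
  then have u0: "word_coeff u 0 = 0" by (cases u) auto
  have "word_coeff u sums (\<Sum>n. word_coeff u (Suc n))"
    using summable_sums[OF assms(3)] u0 by (simp add: sums_Suc_iff)
  then have lim: "word_sum u \<longlonglongrightarrow> (\<Sum>n. word_coeff u (Suc n))"
    unfolding sums_def_le word_sum_def[abs_def] .
  define as where "as = map fst u"
  define zs where "zs = map snd u"
  have "Li_partial as zs = word_sum u"
    by (simp add: fun_eq_iff Li_partial_eq_word_sum as_def zs_def zip_map_fst_snd)
  with lim have L: "Li as zs = (\<Sum>n. word_coeff u (Suc n))" "convergent (Li_partial as zs)"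
    by (auto simp: Li_def limI convergent_def)
  have "length zs = length as" "\<forall>a\<in>set as. a \<ge> 1" "\<forall>\<zeta>\<in>set zs. \<zeta> ^ N = 1" "sum_list as = K"
    using assms(1) by (auto simp: as_def zs_def root_words_def)
  with L(2) have "Li as zs \<in> \<ZZ> K N"
    using assms(2) unfolding \<ZZ>_def
    by (auto intro!: Q.span_base exI[of _ as] exI[of _ zs])
  with L show ?thesis by simp
qed

text \<open>Split the word sum at \<open>n\<close> into its part below \<open>n\<close> and its last
  term: the weight \<tau>^n / n^b prepends a letter to the former and merges with the first letter
  of the latter. The condition on \<open>b\<close> and \<tau> secures convergence of the prepended
  word.\<close>

lemma word_span_zeta_series:
  assumes "f \<in> word_span N K" "N > 0" "K > 0" "b \<ge> 1" "\<tau> ^ N = 1" "b \<ge> 2 \<or> \<tau> = -1"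
  shows "summable (\<lambda>n. f (Suc n) * (\<tau> ^ Suc n / of_nat (Suc n) ^ b))"
    "(\<Sum>n. f (Suc n) * (\<tau> ^ Suc n / of_nat (Suc n) ^ b)) \<in> \<ZZ> (b + K) N"
proof -
  have V: "Q.subspace (\<ZZ> (b + K) N)" using assms(3) by (simp add: \<ZZ>_def)
  have "summable (\<lambda>n. f (Suc n) * (\<tau> ^ Suc n / of_nat (Suc n) ^ b)) \<and>
    (\<Sum>n. f (Suc n) * (\<tau> ^ Suc n / of_nat (Suc n) ^ b)) \<in> \<ZZ> (b + K) N"
    using assms(1) V
  proof (rule seq_span_suminf)
    fix g assume "g \<in> word_sum ` root_words N K"
    then obtain w where w: "w \<in> root_words N K" "g = word_sum w" by auto
    obtain a \<sigma> v K' where v: "w = (a, \<sigma>) # v" "a \<ge> 1" "\<sigma> ^ N = 1" "v \<in> root_words N K'" "K = a + K'"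
      using root_words_Cons_cases[OF w(1) assms(3)] by blast
    have "summable (\<lambda>n. word_coeff ((b, \<tau>) # w) (Suc n))"
    proof (cases "b \<ge> 2")
      case True
      then show ?thesis using summable_word_coeff_Cons_ge_2[OF w(1)] assms by blast
    next
      case False
      then have "b = 1" "\<tau> = -1" using assms by auto
      then show ?thesis using summable_word_coeff_Cons_alternating[OF w(1)] assms by simp
    qed
    moreover from this have "(\<Sum>n. word_coeff ((b, \<tau>) # w) (Suc n)) \<in> \<ZZ> (b + K) N"
      using w assms by (intro suminf_word_coeff_in_ZZ) (auto simp: root_words_Cons)
    \<comment> \<open>The merged exponent a + b is at least 2, whatever \<tau> is.\<close>
    moreover have sm: "summable (\<lambda>n. word_coeff ((a + b, \<sigma> * \<tau>) # v) (Suc n))"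
      using v assms by (intro summable_word_coeff_Cons_ge_2) (auto simp: power_mult_distrib)
    moreover from sm have "(\<Sum>n. word_coeff ((a + b, \<sigma> * \<tau>) # v) (Suc n)) \<in> \<ZZ> (b + K) N"
      using v assms by (intro suminf_word_coeff_in_ZZ) (auto simp: root_words_Cons power_mult_distrib)
    ultimately have "(\<lambda>n. word_coeff ((b, \<tau>) # w) (Suc n) + word_coeff ((a + b, \<sigma> * \<tau>) # v) (Suc n)) sums
        ((\<Sum>n. word_coeff ((b, \<tau>) # w) (Suc n)) + (\<Sum>n. word_coeff ((a + b, \<sigma> * \<tau>) # v) (Suc n)))"
      "((\<Sum>n. word_coeff ((b, \<tau>) # w) (Suc n)) + (\<Sum>n. word_coeff ((a + b, \<sigma> * \<tau>) # v) (Suc n))) \<in> \<ZZ> (b + K) N"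
      by (auto intro!: sums_add Q.subspace_add[OF V] simp del: word_coeff.simps)
    moreover have "word_coeff ((b, \<tau>) # w) (Suc n) + word_coeff ((a + b, \<sigma> * \<tau>) # v) (Suc n)
        = g (Suc n) * (\<tau> ^ Suc n / of_nat (Suc n) ^ b)" for n
      unfolding w(2) word_sum_Suc unfolding v(1) word_coeff_Cons_Suc
      by (simp add: power_add algebra_simps del: of_nat_Suc power_Suc)
    ultimately show "summable (\<lambda>n. g (Suc n) * (\<tau> ^ Suc n / of_nat (Suc n) ^ b)) \<and>
      (\<Sum>n. g (Suc n) * (\<tau> ^ Suc n / of_nat (Suc n) ^ b)) \<in> \<ZZ> (b + K) N"
      by (simp only: sums_iff)
  qed
  then show "summable (\<lambda>n. f (Suc n) * (\<tau> ^ Suc n / of_nat (Suc n) ^ b))"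
    "(\<Sum>n. f (Suc n) * (\<tau> ^ Suc n / of_nat (Suc n) ^ b)) \<in> \<ZZ> (b + K) N" by auto
qed

section \<open>Series of products of harmonic numbers\<close>

theorem mainTheorem5:
  shows
   "(\<forall>(M::nat) (r::nat \<Rightarrow> nat). M \<ge> 1 \<and> (\<forall>j\<in>{1..M}. r j \<ge> 1) \<longrightarrow>
      (\<forall>z::complex. norm z < 1 \<longrightarrow>
         summable (\<lambda>n. (\<Prod>j=1..M. harm_num (r j) (Suc n)) * z ^ Suc n) \<and>
         (\<Sum>n. (\<Prod>j=1..M. harm_num (r j) (Suc n)) * z ^ Suc n)
           \<in> (\<lambda>v. 1 / (1 - z) * v) ` rat_span {L_polylog as z | as. (\<forall>a\<in>set as. a \<ge> 1) \<and> sum_list as = (\<Sum>j=1..M. r j)} \<and>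
         (\<lambda>v. 1 / (1 - z) * v) ` rat_span {L_polylog as z | as. (\<forall>a\<in>set as. a \<ge> 1) \<and> sum_list as = (\<Sum>j=1..M. r j)}
           = (\<lambda>v. v / (1 - z)) ` \<GG> z (\<Sum>j=1..M. r j) 1) \<and>
      (\<forall>s k::nat. s \<ge> 1 \<and> k = s + (\<Sum>j=1..M. r j) \<longrightarrow>
         summable (\<lambda>n. (\<Prod>j=1..M. harm_num (r j) (Suc n)) * (1 / of_nat (Suc n) ^ (s + 1))) \<and>
         (\<Sum>n. (\<Prod>j=1..M. harm_num (r j) (Suc n)) * (1 / of_nat (Suc n) ^ (s + 1))) \<in> \<ZZ> (k + 1) 1 \<and>
         summable (\<lambda>n. (\<Prod>j=1..M. harm_num (r j) (Suc n)) * ((-1) ^ Suc n / of_nat (Suc n) ^ s)) \<and>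
         (\<Sum>n. (\<Prod>j=1..M. harm_num (r j) (Suc n)) * ((-1) ^ Suc n / of_nat (Suc n) ^ s)) \<in> \<ZZ> k 2))
    \<and>
    (\<forall>(M::nat) (M'::nat) (r::nat \<Rightarrow> nat) (r'::nat \<Rightarrow> nat).
      M \<ge> 1 \<and> M' \<ge> 1 \<and> (\<forall>j\<in>{1..M}. r j \<ge> 1) \<and> (\<forall>j\<in>{1..M'}. r' j \<ge> 1) \<longrightarrow>
      (\<forall>z::complex. norm z < 1 \<longrightarrow>
         summable (\<lambda>n. (\<Prod>j=1..M. harm_num (r j) (Suc n)) * (\<Prod>j=1..M'. alt_harm_num (r' j) (Suc n)) * z ^ Suc n) \<and>
         (\<Sum>n. (\<Prod>j=1..M. harm_num (r j) (Suc n)) * (\<Prod>j=1..M'. alt_harm_num (r' j) (Suc n)) * z ^ Suc n)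
           \<in> (\<lambda>v. v / (1 - z)) ` \<GG> z ((\<Sum>j=1..M. r j) + (\<Sum>j=1..M'. r' j)) 2) \<and>
      (\<forall>s k::nat. s \<ge> 1 \<and> k = s + (\<Sum>j=1..M. r j) + (\<Sum>j=1..M'. r' j) \<longrightarrow>
         summable (\<lambda>n. (\<Prod>j=1..M. harm_num (r j) (Suc n)) * (\<Prod>j=1..M'. alt_harm_num (r' j) (Suc n)) * (1 / of_nat (Suc n) ^ (s + 1))) \<and>
         (\<Sum>n. (\<Prod>j=1..M. harm_num (r j) (Suc n)) * (\<Prod>j=1..M'. alt_harm_num (r' j) (Suc n)) * (1 / of_nat (Suc n) ^ (s + 1))) \<in> \<ZZ> (k + 1) 2 \<and>
         summable (\<lambda>n. (\<Prod>j=1..M. harm_num (r j) (Suc n)) * (\<Prod>j=1..M'. alt_harm_num (r' j) (Suc n)) * ((-1) ^ Suc n / of_nat (Suc n) ^ s)) \<and>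
         (\<Sum>n. (\<Prod>j=1..M. harm_num (r j) (Suc n)) * (\<Prod>j=1..M'. alt_harm_num (r' j) (Suc n)) * ((-1) ^ Suc n / of_nat (Suc n) ^ s)) \<in> \<ZZ> k 2))"
proof (intro conjI allI impI)
  fix M :: nat and r :: "nat \<Rightarrow> nat" and z :: complex
  assume r: "M \<ge> 1 \<and> (\<forall>j\<in>{1..M}. r j \<ge> 1)" and z: "norm z < 1"
  define K where "K = (\<Sum>j=1..M. r j)"
  have K: "K > 0" using r unfolding K_def by (intro sum_pos) (auto simp: Suc_le_eq)
  note f = word_span_power_series[OF prod_harm_num_in_word_span[of M r 1] _ _ z, folded K_def]
  show "summable (\<lambda>n. (\<Prod>j=1..M. harm_num (r j) (Suc n)) * z ^ Suc n)"
    using f(1) r K by simp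
  show *: "(\<lambda>v. 1 / (1 - z) * v) ` rat_span {L_polylog as z | as. (\<forall>a\<in>set as. a \<ge> 1) \<and> sum_list as = (\<Sum>j=1..M. r j)}
      = (\<lambda>v. v / (1 - z)) ` \<GG> z (\<Sum>j=1..M. r j) 1"
    using L_polylog_span_eq_GG[OF K z] unfolding K_def by simp
  show "(\<Sum>n. (\<Prod>j=1..M. harm_num (r j) (Suc n)) * z ^ Suc n)
      \<in> (\<lambda>v. 1 / (1 - z) * v) ` rat_span {L_polylog as z | as. (\<forall>a\<in>set as. a \<ge> 1) \<and> sum_list as = (\<Sum>j=1..M. r j)}"
    unfolding * using f(2) r K by (simp add: K_def)
next
  fix M :: nat and r :: "nat \<Rightarrow> nat" and s k :: nat
  assume r: "M \<ge> 1 \<and> (\<forall>j\<in>{1..M}. r j \<ge> 1)" and s: "s \<ge> 1 \<and> k = s + (\<Sum>j=1..M. r j)"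
  define K where "K = (\<Sum>j=1..M. r j)"
  have K: "K > 0" using r unfolding K_def by (intro sum_pos) (auto simp: Suc_le_eq)
  \<comment> \<open>Kept general in \<open>N\<close>: the plain series uses N = 1, while the
    alternating one needs the letter -1 and hence N = 2.\<close>
  have f: "(\<lambda>n. \<Prod>j=1..M. harm_num (r j) n) \<in> word_span N K" for N
    unfolding K_def using r by (intro prod_harm_num_in_word_span) simp
  note pos = word_span_zeta_series[OF f[of 1] _ K, of "s + 1" 1]
  note alt = word_span_zeta_series[OF f[of 2] _ K, of s "-1"]
  show "summable (\<lambda>n. (\<Prod>j=1..M. harm_num (r j) (Suc n)) * (1 / of_nat (Suc n) ^ (s + 1)))"
    using pos(1) s by simp
  show "(\<Sum>n. (\<Prod>j=1..M. harm_num (r j) (Suc n)) * (1 / of_nat (Suc n) ^ (s + 1))) \<in> \<ZZ> (k + 1) 1"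
    using pos(2) s by (simp add: K_def)
  show "summable (\<lambda>n. (\<Prod>j=1..M. harm_num (r j) (Suc n)) * ((-1) ^ Suc n / of_nat (Suc n) ^ s))"
    using alt(1) s by simp
  show "(\<Sum>n. (\<Prod>j=1..M. harm_num (r j) (Suc n)) * ((-1) ^ Suc n / of_nat (Suc n) ^ s)) \<in> \<ZZ> k 2"
    using alt(2) s by (simp add: K_def)
next
  fix M M' :: nat and r r' :: "nat \<Rightarrow> nat" and z :: complex
  assume r: "M \<ge> 1 \<and> M' \<ge> 1 \<and> (\<forall>j\<in>{1..M}. r j \<ge> 1) \<and> (\<forall>j\<in>{1..M'}. r' j \<ge> 1)" and z: "norm z < 1"
  define K where "K = (\<Sum>j=1..M. r j) + (\<Sum>j=1..M'. r' j)"
  have K: "K > 0" using r unfolding K_def by (intro add_pos_pos sum_pos) (auto simp: Suc_le_eq)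
  have f: "(\<lambda>n. (\<Prod>j=1..M. harm_num (r j) n) * (\<Prod>j=1..M'. alt_harm_num (r' j) n)) \<in> word_span 2 K"
    unfolding K_def using r by (intro prod_harm_num_alt_harm_num_in_word_span) simp_all
  note ps = word_span_power_series[OF f _ K z]
  show "summable (\<lambda>n. (\<Prod>j=1..M. harm_num (r j) (Suc n)) * (\<Prod>j=1..M'. alt_harm_num (r' j) (Suc n)) * z ^ Suc n)"
    using ps(1) by simp
  show "(\<Sum>n. (\<Prod>j=1..M. harm_num (r j) (Suc n)) * (\<Prod>j=1..M'. alt_harm_num (r' j) (Suc n)) * z ^ Suc n)
      \<in> (\<lambda>v. v / (1 - z)) ` \<GG> z ((\<Sum>j=1..M. r j) + (\<Sum>j=1..M'. r' j)) 2"
    using ps(2) by (simp add: K_def)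
next
  fix M M' :: nat and r r' :: "nat \<Rightarrow> nat" and s k :: nat
  assume r: "M \<ge> 1 \<and> M' \<ge> 1 \<and> (\<forall>j\<in>{1..M}. r j \<ge> 1) \<and> (\<forall>j\<in>{1..M'}. r' j \<ge> 1)"
    and s: "s \<ge> 1 \<and> k = s + (\<Sum>j=1..M. r j) + (\<Sum>j=1..M'. r' j)"
  define K where "K = (\<Sum>j=1..M. r j) + (\<Sum>j=1..M'. r' j)"
  have K: "K > 0" using r unfolding K_def by (intro add_pos_pos sum_pos) (auto simp: Suc_le_eq)
  have k: "k = s + K" using s by (simp add: K_def)
  have f: "(\<lambda>n. (\<Prod>j=1..M. harm_num (r j) n) * (\<Prod>j=1..M'. alt_harm_num (r' j) n)) \<in> word_span 2 K"
    unfolding K_def using r by (intro prod_harm_num_alt_harm_num_in_word_span) simp_all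
  note pos = word_span_zeta_series[OF f _ K, of "s + 1" 1]
  note alt = word_span_zeta_series[OF f _ K, of s "-1"]
  show "summable (\<lambda>n. (\<Prod>j=1..M. harm_num (r j) (Suc n)) * (\<Prod>j=1..M'. alt_harm_num (r' j) (Suc n)) * (1 / of_nat (Suc n) ^ (s + 1)))"
    using pos(1) s by simp
  show "(\<Sum>n. (\<Prod>j=1..M. harm_num (r j) (Suc n)) * (\<Prod>j=1..M'. alt_harm_num (r' j) (Suc n)) * (1 / of_nat (Suc n) ^ (s + 1))) \<in> \<ZZ> (k + 1) 2"
    using pos(2) s k by simp
  show "summable (\<lambda>n. (\<Prod>j=1..M. harm_num (r j) (Suc n)) * (\<Prod>j=1..M'. alt_harm_num (r' j) (Suc n)) * ((-1) ^ Suc n / of_nat (Suc n) ^ s))"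
    using alt(1) s by simp
  show "(\<Sum>n. (\<Prod>j=1..M. harm_num (r j) (Suc n)) * (\<Prod>j=1..M'. alt_harm_num (r' j) (Suc n)) * ((-1) ^ Suc n / of_nat (Suc n) ^ s)) \<in> \<ZZ> k 2"
    using alt(2) s k by simp
qed

end
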